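(* Let $(K,v)$ be a valued field with valuation ring $\mathcal{O}_v$, and let $I_1,I_2$ be $\mathcal{O}_v$-ideals. Consider the equation $$I_1J=I_2\qquad(\mathrm{E})$$ for $\mathcal{O}_v$-ideals $J$, and the condition $( * )$ $\mathcal{O}(I_1)\subseteq\mathcal{O}(I_2)$, and $I_2$ is a nonprincipal $\mathcal{O}(I_2)$-ideal if $I_1$ is a nonprincipal $\mathcal{O}(I_2)$-ideal. If $( * )$ holds, then $J=I_2:I_1$ is the largest solution of (E), and it is equal to: - $a^{-1}I_2$ if $I_1\mathcal{O}(I_2)=a\mathcal{O}(I_2)$ with $a\in K$; - $(I_2(\mathcal{O}_v:I_1))^{\diamondsuit}$ if $I_1\mathcal{O}(I_2)$ is a nonprincipal $\mathcal{O}(I_2)$-ideal. If $( * )$ does not hold, or equivalently, one of the cases i) $\mathcal{O}(I_2)\subsetneq\mathcal{O}(I_1)$, or ii) $\mathcal{O}(I_1)=\mathcal{O}(I_2)$ and $I_1$ is a nonprincipal $\mathcal{O}(I_1)$-ideal, but $I_2$ is a principal $\mathcal{O}(I_1)$-ideal holds, then (E) has no solution.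
   Context: For a valuation ring $\mathcal{O}$ of $K$, an $\mathcal{O}$-ideal means a nonzero $\mathcal{O}$-submodule $I\subsetneq K$ (so fractional ideals are included). It is principal if it is of the form $a\mathcal{O}$ with $a\in K$, and nonprincipal otherwise. "$I$ is a nonprincipal $\mathcal{O}$-ideal" means that $I$ is an $\mathcal{O}$-ideal and is not principal. "Largest" refers to inclusion. For $\mathcal{O}_v$-ideals, $I_2:I_1:=\{a\in K\mid aI_1\subseteq I_2\}$, and $I_1J$ is the usual product of ideals (the $\mathcal{O}_v$-module generated by products). The invariance valuation ring of an $\mathcal{O}_v$-ideal $I$ is $\mathcal{O}(I):=\{b\in K\mid bI\subseteq I\}$; it is a valuation ring of $K$ containing $\mathcal{O}_v$, and $I$ is an $\mathcal{O}(I)$-ideal. For a valuation ring $\mathcal{O}\supseteq\mathcal{O}_v$ of $K$ with associated valuation $w$ and value group $wK$, and an $\mathcal{O}$-ideal $J$, put $wJ:=\{wb\mid 0\ne b\in J\}$ and define $\widehat J_{\mathcal{O}}:=a\mathcal{O}$ if there exists $a\in K$ such that $wa$ is the infimum of $wJ$ in $wK$, and $\widehat J_{\mathcal{O}}:=J$ otherwise. For an $\mathcal{O}_v$-ideal $J$, $J^{\diamondsuit}:=\widehat J_{\mathcal{O}(J)}$. *)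

theory Defs
  imports "HOL.Hull" "HOL-Library.Extended" "HOL-Algebra.Order"
begin

text \<open>The target group of \<open>v\<close> may be larger than the value group.\<close>

definition is_valuation :: "('a::field \<Rightarrow> 'g::linordered_ab_group_add extended) \<Rightarrow> bool" where
  "is_valuation v \<longleftrightarrow>
     (\<forall>x. v x \<noteq> Minf) \<and>
     (\<forall>x. v x = Pinf \<longleftrightarrow> x = 0) \<and>
     (\<forall>x y. v (x * y) = v x + v y) \<and>
     (\<forall>x y. min (v x) (v y) \<le> v (x + y))"

definition val_ring :: "('a::field \<Rightarrow> 'g::linordered_ab_group_add extended) \<Rightarrow> 'a set" where
  "val_ring v = {x. 0 \<le> v x}"

definition is_submodule :: "'a::field set \<Rightarrow> 'a set \<Rightarrow> bool" where
  "is_submodule R M \<longleftrightarrow>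
     0 \<in> M \<and> (\<forall>x\<in>M. \<forall>y\<in>M. x + y \<in> M) \<and> (\<forall>r\<in>R. \<forall>x\<in>M. r * x \<in> M)"

definition is_ideal :: "'a::field set \<Rightarrow> 'a set \<Rightarrow> bool" where
  "is_ideal R I \<longleftrightarrow> is_submodule R I \<and> I \<noteq> {0} \<and> I \<noteq> UNIV"

definition scale :: "'a::field \<Rightarrow> 'a set \<Rightarrow> 'a set" where
  "scale a S = (\<lambda>x. a * x) ` S"

definition principal_ideal :: "'a::field set \<Rightarrow> 'a set \<Rightarrow> bool" where
  "principal_ideal R I \<longleftrightarrow> is_ideal R I \<and> (\<exists>a. I = scale a R)"

definition nonprincipal_ideal :: "'a::field set \<Rightarrow> 'a set \<Rightarrow> bool" where
  "nonprincipal_ideal R I \<longleftrightarrow> is_ideal R I \<and> \<not> (\<exists>a. I = scale a R)"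

definition ideal_prod :: "'a::field set \<Rightarrow> 'a set \<Rightarrow> 'a set \<Rightarrow> 'a set" where
  "ideal_prod R I J = is_submodule R hull {x * y | x y. x \<in> I \<and> y \<in> J}"

text \<open>\<open>colon J I\<close> is the quotient usually written \<open>J : I\<close>.\<close>

definition colon :: "'a::field set \<Rightarrow> 'a set \<Rightarrow> 'a set" where
  "colon J I = {a. scale a I \<subseteq> J}"

definition inv_ring :: "'a::field set \<Rightarrow> 'a set" where
  "inv_ring I = {b. scale b I \<subseteq> I}"

text \<open>
  The valuation \<open>w\<close> associated with a valuation ring \<open>R\<close> sends a nonzero \<open>a\<close> to its coset
  modulo the units of \<open>R\<close>; its value group is the group of these cosets, ordered by
  \<open>w a \<le> w b\<close> iff \<open>b / a \<in> R\<close>.  Only the ordered set underlying the value group is recorded, since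
  nothing but infima is taken in it.
\<close>

definition assoc_val :: "'a::field set \<Rightarrow> 'a \<Rightarrow> 'a set" where
  "assoc_val R a = scale a {u \<in> R. u \<noteq> 0 \<and> inverse u \<in> R}"

definition value_group :: "'a::field set \<Rightarrow> 'a set gorder" where
  "value_group R =
     \<lparr> carrier = assoc_val R ` (- {0}), eq = (=),
       le = (\<lambda>A B. \<exists>a\<in>A. \<exists>b\<in>B. b / a \<in> R) \<rparr>"

lemma le_value_group_iff:
  assumes one: "1 \<in> R" and mult: "\<And>x y. x \<in> R \<Longrightarrow> y \<in> R \<Longrightarrow> x * y \<in> R"
    and "a \<noteq> 0"
  shows "assoc_val R a \<sqsubseteq>\<^bsub>value_group R\<^esub> assoc_val R b \<longleftrightarrow> b / a \<in> R"
proof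
  assume "assoc_val R a \<sqsubseteq>\<^bsub>value_group R\<^esub> assoc_val R b"
  then obtain u t where u: "u \<in> R" "u \<noteq> 0" and t: "t \<noteq> 0" "inverse t \<in> R"
    and q: "(b * t) / (a * u) \<in> R"
    by (auto simp: value_group_def assoc_val_def scale_def)
  have "b / a = inverse t * (u * ((b * t) / (a * u)))"
    using u t \<open>a \<noteq> 0\<close> by (simp add: field_simps)
  moreover have "inverse t * (u * ((b * t) / (a * u))) \<in> R"
    by (intro mult u t q)
  ultimately show "b / a \<in> R" by (rule ssubst)
next
  assume "b / a \<in> R"
  moreover have "x \<in> assoc_val R x" for x
    using one by (auto simp: assoc_val_def scale_def intro!: image_eqI[of _ _ 1])
  ultimately show "assoc_val R a \<sqsubseteq>\<^bsub>value_group R\<^esub> assoc_val R b"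
    by (auto simp: value_group_def)
qed

text \<open>The choice of \<open>a\<close> is immaterial: \<open>w a\<close> determines the principal ideal \<open>a R\<close>.\<close>

definition hat :: "'a::field set \<Rightarrow> 'a set \<Rightarrow> 'a set" where
  "hat R J =
     (let is_inf = (\<lambda>a. a \<noteq> 0 \<and> is_glb (value_group R) (assoc_val R a) (assoc_val R ` (J - {0})))
      in if \<exists>a. is_inf a then scale (SOME a. is_inf a) R else J)"

definition diamond :: "'a::field set \<Rightarrow> 'a set" where
  "diamond J = hat (inv_ring J) J"

definition solves :: "'a::field set \<Rightarrow> 'a set \<Rightarrow> 'a set \<Rightarrow> 'a set \<Rightarrow> bool" where
  "solves R I1 I2 J \<longleftrightarrow> is_ideal R J \<and> ideal_prod R I1 J = I2"

text \<open>
  The second conjunct holds vacuously if \<open>I1\<close> is not a module over \<open>inv_ring I2\<close>.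
\<close>

definition cond_star :: "'a::field set \<Rightarrow> 'a set \<Rightarrow> bool" where
  "cond_star I1 I2 \<longleftrightarrow>
     inv_ring I1 \<subseteq> inv_ring I2 \<and>
     (nonprincipal_ideal (inv_ring I2) I1 \<longrightarrow> nonprincipal_ideal (inv_ring I2) I2)"

end

theory Submission
  imports Defs
begin

text \<open>
  Over a valuation ring, a product \<open>I J\<close> of modules consists of the products \<open>x y\<close> alone, and a
  module is compared with single elements: if \<open>y \<in> M\<close> and \<open>x \<notin> M\<close>, then \<open>y / x\<close> is a nonunit.
  Put \<open>S = \<O>(I\<^sub>2)\<close>. The equation forces \<open>\<O>(I\<^sub>1) \<subseteq> S\<close>. If \<open>I\<^sub>1 S = a S\<close>, then everything is
  immediate. Otherwise \<open>I\<^sub>1\<close> is already an \<open>S\<close>-module, so \<open>\<O>(I\<^sub>1) = S\<close>. For \<open>c, d \<in> I\<^sub>2\<close>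
  with \<open>c / d\<close> a nonunit, \<open>d / c\<close> does not stabilise \<open>I\<^sub>1\<close>, say \<open>(d / c) x \<notin> I\<^sub>1\<close> with \<open>x \<in> I\<^sub>1\<close>;
  then \<open>c / x\<close> lies in \<open>I\<^sub>2 : I\<^sub>1\<close>, which gives \<open>c \<in> I\<^sub>1 (I\<^sub>2 : I\<^sub>1)\<close>. The same argument gives
  \<open>\<mm> (I\<^sub>2 : I\<^sub>1) \<subseteq> I\<^sub>2 (\<O> : I\<^sub>1) \<subseteq> I\<^sub>2 : I\<^sub>1\<close>, where \<open>\<mm>\<close>, the maximal ideal of \<open>S\<close>, is idempotent
  because \<open>I\<^sub>1\<close> is not principal; passing to the infimum closes the remaining gap.
\<close>

section \<open>Elementwise descriptions of scalings, quotients and stabilisers\<close>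

lemma mem_scale_iff: "a \<noteq> 0 \<Longrightarrow> x \<in> scale a S \<longleftrightarrow> x / a \<in> S"
  by (force simp: scale_def field_simps)

lemma mem_colon_iff: "a \<in> colon J I \<longleftrightarrow> (\<forall>x\<in>I. a * x \<in> J)"
  by (auto simp: colon_def scale_def)

lemma mem_inv_ring_iff: "a \<in> inv_ring I \<longleftrightarrow> (\<forall>x\<in>I. a * x \<in> I)"
  by (auto simp: inv_ring_def scale_def)

lemma is_submodule_antimono: "R \<subseteq> S \<Longrightarrow> is_submodule S M \<Longrightarrow> is_submodule R M"
  by (auto simp: is_submodule_def)

lemma submodule_mult: "is_submodule R M \<Longrightarrow> r \<in> R \<Longrightarrow> x \<in> M \<Longrightarrow> r * x \<in> M"
  by (simp add: is_submodule_def)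

lemma is_ideal_inv_ring: "is_ideal R I \<Longrightarrow> is_ideal (inv_ring I) I"
  by (simp add: is_ideal_def is_submodule_def mem_inv_ring_iff)

lemma ideal_subset_inv_ring: "is_ideal R I \<Longrightarrow> R \<subseteq> inv_ring I"
  by (auto simp: is_ideal_def is_submodule_def mem_inv_ring_iff)

lemma ideal_nonzero_element:
  assumes "is_ideal R I" obtains x where "x \<in> I" "x \<noteq> 0"
  using assms by (auto simp: is_ideal_def is_submodule_def)

lemma is_submodule_colon:
  assumes "is_submodule R J" shows "is_submodule R (colon J I)"
  using assms by (auto simp: is_submodule_def mem_colon_iff distrib_right mult.assoc)

section \<open>Valuation rings, their modules and their maximal ideals\<close>

locale valuation_ring =
  fixes R :: "'a::field set"
  assumes one_mem: "1 \<in> R"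
    and add_mem: "x \<in> R \<Longrightarrow> y \<in> R \<Longrightarrow> x + y \<in> R"
    and mult_mem: "x \<in> R \<Longrightarrow> y \<in> R \<Longrightarrow> x * y \<in> R"
    and total: "x \<in> R \<or> inverse x \<in> R"
begin

lemma zero_mem: "0 \<in> R"
  using total[of 0] by simp

text \<open>The maximal ideal of \<open>R\<close>. Zero is listed separately because
  \<open>inverse 0 = 0\<close> lies in \<open>R\<close>.\<close>

definition nonunits :: "'a set" where
  "nonunits = {x. x = 0 \<or> inverse x \<notin> R}"

lemma nonunits_subset: "nonunits \<subseteq> R"
  using total zero_mem by (auto simp: nonunits_def)

lemma div_mem_nonunits:
  assumes "is_submodule R M" "y \<in> M" "x \<notin> M"
  shows "y / x \<in> nonunits"
proof (rule ccontr)
  assume "y / x \<notin> nonunits"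
  then have "y \<noteq> 0" "x / y \<in> R" by (auto simp: nonunits_def)
  then have "(x / y) * y \<in> M" using submodule_mult[OF assms(1)] assms(2) by blast
  with assms \<open>y \<noteq> 0\<close> show False by simp
qed

lemma subset_scale:
  assumes "is_submodule R M" "x \<notin> M"
  shows "M \<subseteq> scale x R"
proof -
  have "x \<noteq> 0" using assms by (auto simp: is_submodule_def)
  then show ?thesis
    using div_mem_nonunits[OF assms(1) _ assms(2)] nonunits_subset by (meson mem_scale_iff subset_iff)
qed

lemma scale_subset: "is_submodule R M \<Longrightarrow> x \<in> M \<Longrightarrow> scale x R \<subseteq> M"
  by (auto simp: is_submodule_def scale_def mult.commute[of x])

lemma submodule_linear:
  assumes "is_submodule R M" "is_submodule R N"
  shows "M \<subseteq> N \<or> N \<subseteq> M"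
  using subset_scale[OF assms(2)] scale_subset[OF assms(1)] by blast

lemma is_submodule_self: "is_submodule R R"
  by (simp add: is_submodule_def zero_mem add_mem mult_mem)

lemma is_submodule_scale: "is_submodule R M \<Longrightarrow> is_submodule R (scale a M)"
  unfolding is_submodule_def scale_def
  by (auto simp: image_iff distrib_left[symmetric] mult.left_commute[of _ a])

text \<open>Of two nonzero products one is an \<open>R\<close>-multiple of the other, so their sum
  is again a single product: the factor \<open>1 + r\<close> with \<open>r\<close> in
  \<open>R\<close> is absorbed by \<open>J\<close>.\<close>

lemma is_submodule_products:
  assumes I: "is_submodule R I" and J: "is_submodule R J"
  shows "is_submodule R {x * y | x y. x \<in> I \<and> y \<in> J}" (is "is_submodule R ?P")
proof -
  have "x * y + x' * y' \<in> ?P" if "x \<in> I" "y \<in> J" "x' \<in> I" "y' \<in> J" for x y x' y'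
  proof -
    have *: "a * b + a' * b' \<in> ?P"
      if "a \<in> I" "b \<in> J" "a * b \<noteq> 0" "(a' * b') / (a * b) \<in> R" for a b a' b'
    proof -
      have "(1 + (a' * b') / (a * b)) * b \<in> J"
        using that J add_mem[OF one_mem] by (auto simp: is_submodule_def)
      moreover have "a * b + a' * b' = a * ((1 + (a' * b') / (a * b)) * b)"
        using that by (simp add: field_simps)
      ultimately show ?thesis using that by blast
    qed
    \<comment> \<open>The first two cases cover a vanishing summand; otherwise totality of
      \<open>R\<close> decides which product divides the other.\<close>
    consider "x * y + x' * y' = x * y" | "x * y + x' * y' = x' * y'"
      | "x * y \<noteq> 0" "x' * y' \<noteq> 0" "(x' * y') / (x * y) \<in> R"
      | "x * y \<noteq> 0" "x' * y' \<noteq> 0" "(x * y) / (x' * y') \<in> R"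
      using total[of "(x' * y') / (x * y)"] by fastforce
    then show ?thesis
    proof cases
      case 3
      then show ?thesis using *[of x y x' y'] that by simp
    next
      case 4
      then show ?thesis using *[of x' y' x y] that by (simp add: add.commute)
    qed (use that in \<open>simp only:, blast\<close>)+
  qed
  moreover have "r * (x * y) \<in> ?P" if "r \<in> R" "x \<in> I" "y \<in> J" for r x y
    using submodule_mult[OF I that(1,2)] that(3)
    by (metis (mono_tags, lifting) mem_Collect_eq mult.assoc)
  moreover have "0 \<in> ?P" using I J by (force simp: is_submodule_def)
  ultimately show ?thesis unfolding is_submodule_def by blast
qed

lemma ideal_prod_eq:
  assumes "is_submodule R I" "is_submodule R J"
  shows "ideal_prod R I J = {x * y | x y. x \<in> I \<and> y \<in> J}"
  unfolding ideal_prod_def by (rule hull_same) (rule is_submodule_products[OF assms])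

lemma valuation_ring_inv_ring:
  assumes "is_ideal R I" shows "valuation_ring (inv_ring I)"
proof
  show "x \<in> inv_ring I \<or> inverse x \<in> inv_ring I" for x
    using total[of x] ideal_subset_inv_ring[OF assms] by blast
qed (use assms in \<open>auto simp: mem_inv_ring_iff is_ideal_def is_submodule_def
      distrib_right mult.assoc\<close>)

lemma ideal_bounded:
  assumes "is_ideal R I" obtains x where "x \<noteq> 0" "I \<subseteq> scale x R"
proof -
  obtain x where "x \<notin> I" using assms by (auto simp: is_ideal_def)
  moreover have "is_submodule R I" using assms by (simp add: is_ideal_def)
  ultimately show thesis
    using that[of x] subset_scale[of I x] by (auto simp: is_submodule_def)
qed

lemma nonprincipal_no_generator:
  assumes "nonprincipal_ideal R I" "x \<in> I"
  obtains d where "d \<in> I" "d \<notin> scale x R"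
  using assms scale_subset[of I x] by (auto simp: nonprincipal_ideal_def is_ideal_def)

text \<open>A nonprincipal ideal has no element of least value, so some \<open>d\<close> in
  \<open>I\<close> has value strictly below that of \<open>x\<close>.\<close>

lemma nonprincipal_nonunit_quotient:
  assumes "nonprincipal_ideal R I" "x \<in> I"
  obtains d where "d \<in> I" "d \<noteq> 0" "x / d \<in> nonunits"
proof -
  obtain d where d: "d \<in> I" "d \<notin> scale x R"
    using nonprincipal_no_generator[OF assms] .
  have "is_submodule R (scale x R)" "x \<in> scale x R"
    using is_submodule_scale[OF is_submodule_self] one_mem by (auto simp: scale_def)
  then have "d \<noteq> 0" "x / d \<in> nonunits"
    using d(2) div_mem_nonunits by (auto simp: is_submodule_def)
  with d(1) that show thesis by blast
qed

lemma nonunit_inverse_not_mem: "t \<in> nonunits \<Longrightarrow> t \<noteq> 0 \<Longrightarrow> inverse t \<notin> R"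
  by (simp add: nonunits_def)

lemma not_stabilised:
  assumes "inv_ring I = R" "t \<in> nonunits" "t \<noteq> 0"
  obtains x where "x \<in> I" "x / t \<notin> I"
  using nonunit_inverse_not_mem[OF assms(2,3)] assms(1)
  by (metis divide_inverse_commute mem_inv_ring_iff)

text \<open>Dividing \<open>x\<close> by \<open>t\<close> leaves \<open>I\<close>, whereas
  \<open>d\<close> is in \<open>I\<close> and has smaller value than \<open>x\<close>. So the value
  of \<open>d\<close> lies strictly between those of \<open>x / t\<close> and \<open>x\<close>,
  which splits \<open>t\<close> into the nonunits \<open>d / (x / t)\<close> and
  \<open>x / d\<close>.\<close>

lemma nonunits_idempotent:
  assumes "nonprincipal_ideal R I" "inv_ring I = R" "t \<in> nonunits" "t \<noteq> 0"
  obtains s where "s \<in> nonunits" "s \<noteq> 0" "t / s \<in> nonunits"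
proof -
  have I: "is_submodule R I"
    using assms(1) by (auto simp: nonprincipal_ideal_def is_ideal_def)
  obtain x where x: "x \<in> I" "x / t \<notin> I" using not_stabilised[OF assms(2-4)] .
  obtain d where d: "d \<in> I" "d \<noteq> 0" "x / d \<in> nonunits"
    using nonprincipal_nonunit_quotient[OF assms(1) x(1)] .
  have "x \<noteq> 0" using x I by (auto simp: is_submodule_def)
  have "d / (x / t) \<in> nonunits" by (rule div_mem_nonunits[OF I d(1) x(2)])
  moreover have "t / (d / (x / t)) = x / d" using assms(4) \<open>x \<noteq> 0\<close> d(2) by simp
  ultimately show thesis using that[of "d / (x / t)"] d assms(4) \<open>x \<noteq> 0\<close> by simp
qed

section \<open>Infima in the value group in terms of principal modules\<close>

text \<open>The value of \<open>b\<close> is a lower bound for the values of \<open>J\<close>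
  exactly when \<open>J \<subseteq> scale b R\<close>. An infimum is therefore a generator of the
  smallest principal module containing \<open>J\<close>.\<close>

lemma is_glb_value_group_iff:
  assumes "a \<noteq> 0"
  shows "is_glb (value_group R) (assoc_val R a) (assoc_val R ` (J - {0})) \<longleftrightarrow>
    J \<subseteq> scale a R \<and> (\<forall>b. b \<noteq> 0 \<longrightarrow> J \<subseteq> scale b R \<longrightarrow> a \<in> scale b R)"
proof -
  have le: "b \<noteq> 0 \<Longrightarrow> assoc_val R b \<sqsubseteq>\<^bsub>value_group R\<^esub> assoc_val R x \<longleftrightarrow> x \<in> scale b R" for b x
    by (simp add: le_value_group_iff[OF one_mem mult_mem] mem_scale_iff)
  \<comment> \<open>The values are taken on \<open>J - {0}\<close> only; since \<open>0\<close> lies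
    in every \<open>scale b R\<close>, this set and \<open>J\<close> are contained in the same
    principal modules.\<close>
  have zero: "0 \<in> scale b R" for b using zero_mem by (force simp: scale_def)
  have carrier: "carrier (value_group R) = assoc_val R ` (- {0})"
    by (simp add: value_group_def)
  have lower: "assoc_val R b \<in> Lower (value_group R) (assoc_val R ` (J - {0})) \<longleftrightarrow>
      J \<subseteq> scale b R" if "b \<noteq> 0" for b
  proof -
    have "assoc_val R b \<in> Lower (value_group R) (assoc_val R ` (J - {0})) \<longleftrightarrow>
        (\<forall>x\<in>J - {0}. assoc_val R b \<sqsubseteq>\<^bsub>value_group R\<^esub> assoc_val R x)"
      unfolding Lower_def carrier using that by blast
    also have "\<dots> \<longleftrightarrow> J \<subseteq> scale b R" using zero by (auto simp: le[OF that])
    finally show ?thesis .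
  qed
  define L where "L = Lower (value_group R) (assoc_val R ` (J - {0}))"
  have L: "L \<subseteq> assoc_val R ` (- {0})" unfolding L_def Lower_def carrier by blast
  \<comment> \<open>Members of \<open>L\<close> are cosets; the quantifier is moved to their nonzero
    representatives \<open>b\<close>.\<close>
  have "(\<forall>x\<in>L. x \<sqsubseteq>\<^bsub>value_group R\<^esub> assoc_val R a) \<longleftrightarrow>
      (\<forall>b. b \<noteq> 0 \<longrightarrow> assoc_val R b \<in> L \<longrightarrow> assoc_val R b \<sqsubseteq>\<^bsub>value_group R\<^esub> assoc_val R a)"
    (is "_ \<longleftrightarrow> ?rhs")
  proof
    assume *: ?rhs
    show "\<forall>x\<in>L. x \<sqsubseteq>\<^bsub>value_group R\<^esub> assoc_val R a"
    proof
      fix x assume "x \<in> L"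
      moreover from this L obtain b where "x = assoc_val R b" "b \<noteq> 0" by blast
      ultimately show "x \<sqsubseteq>\<^bsub>value_group R\<^esub> assoc_val R a" using * by simp
    qed
  qed simp
  also have "\<dots> \<longleftrightarrow> (\<forall>b. b \<noteq> 0 \<longrightarrow> J \<subseteq> scale b R \<longrightarrow> a \<in> scale b R)"
    by (simp add: L_def lower le)
  finally have greatest: "(\<forall>x\<in>L. x \<sqsubseteq>\<^bsub>value_group R\<^esub> assoc_val R a) \<longleftrightarrow>
      (\<forall>b. b \<noteq> 0 \<longrightarrow> J \<subseteq> scale b R \<longrightarrow> a \<in> scale b R)" .
  have "assoc_val R a \<in> L \<longleftrightarrow> J \<subseteq> scale a R" using lower[OF assms] by (simp add: L_def)
  with greatest L show ?thesis
    unfolding greatest_def L_def[symmetric] carrier by simp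
qed

text \<open>Serves to compute \<open>hat\<close> without deciding whether an infimum exists. The
  first premise speaks of every infimum \<open>a\<close>, hence also of the one picked by
  \<open>SOME\<close>.\<close>

lemma hat_eq:
  assumes inf: "\<And>a. a \<noteq> 0 \<Longrightarrow> J \<subseteq> scale a R \<Longrightarrow>
      (\<And>b. b \<noteq> 0 \<Longrightarrow> J \<subseteq> scale b R \<Longrightarrow> a \<in> scale b R) \<Longrightarrow> scale a R = C"
    and no_inf: "(\<And>a. a \<noteq> 0 \<Longrightarrow> J \<subseteq> scale a R \<Longrightarrow>
      \<exists>b. b \<noteq> 0 \<and> J \<subseteq> scale b R \<and> a \<notin> scale b R) \<Longrightarrow> J = C"
  shows "hat R J = C"
proof (cases "\<exists>a. a \<noteq> 0 \<and> is_glb (value_group R) (assoc_val R a) (assoc_val R ` (J - {0}))")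
  case True
  then show ?thesis
    using someI_ex[OF True] inf is_glb_value_group_iff unfolding hat_def Let_def by auto
next
  case False
  then show ?thesis
    using no_inf is_glb_value_group_iff unfolding hat_def Let_def by (metis (no_types, lifting))
qed

section \<open>The quotient as the candidate for the largest solution\<close>

lemma prod_colon_subset:
  assumes "is_submodule R I1" "is_submodule R I2"
  shows "ideal_prod R I1 (colon I2 I1) \<subseteq> I2"
  using assms by (auto simp: ideal_prod_eq is_submodule_colon mem_colon_iff mult.commute)

lemma solves_subset_colon:
  assumes "is_ideal R I1" "solves R I1 I2 J"
  shows "J \<subseteq> colon I2 I1"
  using assms by (auto simp: solves_def is_ideal_def ideal_prod_eq mem_colon_iff mult.commute)

text \<open>One inclusion of the equation is automatic, so only factorisations are asked for. A
  factorisation of a nonzero \<open>c\<close> also shows that the quotient is nonzero.\<close>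

lemma solves_colonI:
  assumes I1: "is_ideal R I1" and I2: "is_ideal R I2"
    and factor: "\<And>c. c \<in> I2 \<Longrightarrow> \<exists>x\<in>I1. \<exists>y\<in>colon I2 I1. c = x * y"
  shows "solves R I1 I2 (colon I2 I1)"
proof -
  have sub: "is_submodule R I1" "is_submodule R I2" using I1 I2 by (auto simp: is_ideal_def)
  have C: "is_submodule R (colon I2 I1)" by (rule is_submodule_colon[OF sub(2)])
  have eq: "ideal_prod R I1 (colon I2 I1) = I2"
    using prod_colon_subset[OF sub] factor unfolding ideal_prod_eq[OF sub(1) C] by blast
  obtain c where "c \<in> I2" "c \<noteq> 0" using I2 by (rule ideal_nonzero_element)
  then have "colon I2 I1 \<noteq> {0}" using factor by fastforce
  moreover have "colon I2 I1 \<noteq> UNIV"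
  proof
    assume *: "colon I2 I1 = UNIV"
    obtain x where x: "x \<in> I1" "x \<noteq> 0" using I1 by (rule ideal_nonzero_element)
    have "(z / x) * x \<in> I2" for z using * x(1) by (metis UNIV_I mem_colon_iff)
    then have "I2 = UNIV" using x(2) by auto
    with I2 show False by (simp add: is_ideal_def)
  qed
  ultimately show ?thesis using C eq by (simp add: solves_def is_ideal_def)
qed

text \<open>All of \<open>I1\<close> lies in \<open>scale a S\<close>, and \<open>a\<close> itself
  is \<open>x * s\<close> with \<open>x\<close> in \<open>I1\<close> and \<open>s\<close> in
  \<open>S\<close>. As \<open>I2\<close> absorbs \<open>S\<close>, the condition that
  \<open>y\<close> maps \<open>I1\<close> into \<open>I2\<close> reduces to
  \<open>y * a \<in> I2\<close>.\<close>

lemma colon_principal: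
  assumes I1: "is_ideal R I1" and S: "valuation_ring S" "R \<subseteq> S" and I2: "is_submodule S I2"
    and eq: "ideal_prod R I1 S = scale a S"
  shows "colon I2 I1 = scale (inverse a) I2"
    and "c \<in> I2 \<Longrightarrow> \<exists>x\<in>I1. \<exists>y\<in>colon I2 I1. c = x * y"
proof -
  interpret S: valuation_ring S by fact
  have prod: "scale a S = {x * y | x y. x \<in> I1 \<and> y \<in> S}"
    using ideal_prod_eq[of I1 S] is_submodule_antimono[OF S(2) S.is_submodule_self] I1 eq
    by (auto simp: is_ideal_def)
  have sub: "x \<in> scale a S" if "x \<in> I1" for x
    unfolding prod using that S.one_mem by force
  have "a \<noteq> 0"
  proof
    assume "a = 0"
    then have "I1 \<subseteq> {0}" using sub by (auto simp: scale_def)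
    with I1 show False by (auto elim: ideal_nonzero_element)
  qed
  have "a \<in> scale a S" using S.one_mem by (force simp: scale_def)
  then obtain x s where a: "a = x * s" "x \<in> I1" "s \<in> S" unfolding prod by blast
  show colon: "colon I2 I1 = scale (inverse a) I2"
  proof (intro equalityI subsetI)
    fix y assume "y \<in> colon I2 I1"
    then have "s * (y * x) \<in> I2" using I2 a by (auto simp: is_submodule_def mem_colon_iff)
    then show "y \<in> scale (inverse a) I2"
      using \<open>a \<noteq> 0\<close> a(1) by (simp add: mem_scale_iff field_simps)
  next
    fix y assume y: "y \<in> scale (inverse a) I2"
    have "y * z \<in> I2" if "z \<in> I1" for z
    proof -
      have "(z / a) * (y * a) \<in> I2"
        using sub[OF that] y \<open>a \<noteq> 0\<close>
        by (intro submodule_mult[OF I2, of "z / a" "y * a"])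
          (simp_all add: mem_scale_iff divide_inverse)
      then show ?thesis using \<open>a \<noteq> 0\<close> by (simp add: field_simps)
    qed
    then show "y \<in> colon I2 I1" by (simp add: mem_colon_iff)
  qed
  assume "c \<in> I2"
  then have "s * c \<in> I2" using a(3) I2 by (auto simp: is_submodule_def)
  \<comment> \<open>Since \<open>a = x * s\<close>, this is the cofactor of \<open>x\<close> in
    \<open>c\<close>.\<close>
  then have "s * c / a \<in> colon I2 I1" using \<open>a \<noteq> 0\<close> by (simp add: colon mem_scale_iff)
  moreover have "c = x * (s * c / a)" using a(1) \<open>a \<noteq> 0\<close> by simp
  ultimately show "\<exists>x\<in>I1. \<exists>y\<in>colon I2 I1. c = x * y" using a(2) by blast
qed

section \<open>Extending an ideal to a larger valuation ring\<close>

text \<open>Properness is the main point: \<open>I \<subseteq> scale x R\<close> bounds the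
  extension by \<open>scale x S\<close>, which is not the whole field because \<open>S\<close> is
  not.\<close>

lemma is_ideal_extension:
  assumes I: "is_ideal R I" and S: "valuation_ring S" "R \<subseteq> S" "S \<noteq> UNIV"
  shows "is_ideal S (ideal_prod R I S)"
proof -
  interpret S: valuation_ring S by fact
  have sub: "is_submodule R I" "is_submodule R S"
    using I is_submodule_antimono[OF S(2) S.is_submodule_self] by (auto simp: is_ideal_def)
  have prod: "ideal_prod R I S = {x * y | x y. x \<in> I \<and> y \<in> S}"
    by (rule ideal_prod_eq[OF sub])
  have "is_submodule R (ideal_prod R I S)"
    unfolding prod by (rule is_submodule_products[OF sub])
  moreover have "s * (x * y) \<in> ideal_prod R I S" if "s \<in> S" "x \<in> I" "y \<in> S" for s x y
  proof -
    have "s * y \<in> S" "s * (x * y) = x * (s * y)"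
      using that S.mult_mem by auto
    with that(2) show ?thesis unfolding prod by blast
  qed
  ultimately have "is_submodule S (ideal_prod R I S)"
    unfolding is_submodule_def prod by blast
  moreover have "ideal_prod R I S \<noteq> {0}"
  proof -
    obtain x where "x \<in> I" "x \<noteq> 0" using I by (rule ideal_nonzero_element)
    moreover have "x \<in> ideal_prod R I S" if "x \<in> I" for x
      unfolding prod using that S.one_mem by force
    ultimately show ?thesis by blast
  qed
  moreover have "ideal_prod R I S \<noteq> UNIV"
  proof
    assume UNIV: "ideal_prod R I S = UNIV"
    obtain x where x: "x \<noteq> 0" "I \<subseteq> scale x R" using ideal_bounded[OF I] .
    have "z \<in> S" for z
    proof -
      obtain y s where ys: "z * x = y * s" "y \<in> I" "s \<in> S" using UNIV prod by blast
      have "y / x \<in> S" using x S(2) ys(2) mem_scale_iff[OF x(1), of y R] by blast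
      then have "(y / x) * s \<in> S" using ys(3) by (rule S.mult_mem)
      moreover have "(y / x) * s = z" using ys x by (simp add: field_simps)
      ultimately show ?thesis by simp
    qed
    with S(3) show False by blast
  qed
  ultimately show ?thesis by (simp add: is_ideal_def)
qed

text \<open>A nonprincipal extension has no element of minimal value over \<open>S\<close>, so that multiplying by
  elements of \<open>S\<close> never leads out of \<open>I\<close>.\<close>

lemma nonprincipal_extension_eq:
  assumes I: "is_ideal R I" and S: "valuation_ring S" "R \<subseteq> S"
    and np: "nonprincipal_ideal S (ideal_prod R I S)"
  shows "ideal_prod R I S = I"
proof -
  interpret S: valuation_ring S by fact
  have sub: "is_submodule R I" "is_submodule R S"
    using I is_submodule_antimono[OF S(2) S.is_submodule_self] by (auto simp: is_ideal_def)
  have prod: "ideal_prod R I S = {x * y | x y. x \<in> I \<and> y \<in> S}"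
    by (rule ideal_prod_eq[OF sub])
  have "x \<in> I" if x: "x \<in> ideal_prod R I S" for x
  proof (rule ccontr)
    assume "x \<notin> I"
    obtain d where d: "d \<in> ideal_prod R I S" "d \<noteq> 0" "x / d \<in> S.nonunits"
      using S.nonprincipal_nonunit_quotient[OF np x] .
    obtain y s where ys: "d = y * s" "y \<in> I" "s \<in> S" using d(1) prod by blast
    \<comment> \<open>Over \<open>S\<close>, \<open>d\<close> lies strictly below \<open>x\<close>.
      But \<open>y\<close> is in \<open>I\<close> and \<open>x\<close> is not, so
      \<open>y / x\<close>, and with it \<open>d / x\<close>, belongs to \<open>S\<close>.\<close>
    have "y / x \<in> S" using div_mem_nonunits[OF sub(1) ys(2) \<open>x \<notin> I\<close>] nonunits_subset S(2) by blast
    then have "(y / x) * s \<in> S" using ys(3) by (rule S.mult_mem)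
    moreover have "x \<noteq> 0" using \<open>x \<notin> I\<close> sub by (auto simp: is_submodule_def)
    moreover have "inverse (x / d) \<notin> S"
      using S.nonunit_inverse_not_mem[OF d(3)] d(2) \<open>x \<noteq> 0\<close> by simp
    ultimately show False by (simp add: ys(1))
  qed
  moreover have "x \<in> ideal_prod R I S" if "x \<in> I" for x
    unfolding prod using that S.one_mem by force
  ultimately show ?thesis by blast
qed

section \<open>Two nonprincipal ideals with common invariance ring\<close>

context
  fixes I1 I2 :: "'a set"
  assumes np1: "nonprincipal_ideal R I1" and np2: "nonprincipal_ideal R I2"
    and inv1: "inv_ring I1 = R" and inv2: "inv_ring I2 = R"
begin

lemma nonprincipal_factor:
  assumes c: "c \<in> I2" shows "\<exists>x\<in>I1. \<exists>y\<in>colon I2 I1. c = x * y"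
proof (cases "c = 0")
  case True
  moreover have "0 \<in> I1" "0 \<in> colon I2 I1"
    using np1 np2 by (auto simp: nonprincipal_ideal_def is_ideal_def is_submodule_def mem_colon_iff)
  ultimately show ?thesis by force
next
  case False
  have I: "is_submodule R I1" "is_submodule R I2"
    using np1 np2 by (auto simp: nonprincipal_ideal_def is_ideal_def)
  obtain d where d: "d \<in> I2" "d \<noteq> 0" "c / d \<in> nonunits"
    using nonprincipal_nonunit_quotient[OF np2 c] .
  obtain x where x: "x \<in> I1" "x / (c / d) \<notin> I1"
    using not_stabilised[OF inv1 d(3)] False d(2) by auto
  have "x \<noteq> 0" using x I by (auto simp: is_submodule_def)
  \<comment> \<open>The element \<open>x / (c / d)\<close> lies outside \<open>I1\<close>, hence
    divides each \<open>z\<close> in \<open>I1\<close>. This makes \<open>c / x * z\<close> an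
    \<open>R\<close>-multiple of \<open>d\<close>.\<close>
  have "c / x \<in> colon I2 I1"
    unfolding mem_colon_iff
  proof
    fix z assume "z \<in> I1"
    then have "z / (x / (c / d)) \<in> R"
      using div_mem_nonunits[OF I(1) _ x(2)] nonunits_subset by blast
    then have "z / (x / (c / d)) * d \<in> I2" using d(1) by (rule submodule_mult[OF I(2)])
    moreover have "z / (x / (c / d)) * d = c / x * z" using d(2) by simp
    ultimately show "c / x * z \<in> I2" by simp
  qed
  with x(1) \<open>x \<noteq> 0\<close> show ?thesis by force
qed

text \<open>Whatever stabilises the quotient stabilises its products with elements of
  \<open>I1\<close>; these exhaust \<open>I2\<close>, whose stabiliser is \<open>R\<close>.\<close>

lemma inv_ring_colon: "inv_ring (colon I2 I1) = R"
proof (intro equalityI subsetI)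
  fix b assume b: "b \<in> inv_ring (colon I2 I1)"
  have "b * c \<in> I2" if c: "c \<in> I2" for c
  proof -
    obtain x y where "x \<in> I1" "y \<in> colon I2 I1" "c = x * y"
      using nonprincipal_factor[OF c] by blast
    moreover from this b have "(b * y) * x \<in> I2" by (simp add: mem_inv_ring_iff mem_colon_iff)
    ultimately show ?thesis by (simp add: ac_simps)
  qed
  then show "b \<in> R" using inv2 by (auto simp: mem_inv_ring_iff)
next
  fix b assume "b \<in> R"
  then show "b \<in> inv_ring (colon I2 I1)"
    using is_submodule_colon[of R I2 I1] np2
    by (auto simp: mem_inv_ring_iff is_submodule_def nonprincipal_ideal_def is_ideal_def)
qed

text \<open>Ensures that \<open>diamond J\<close> is formed over \<open>R\<close>. If
  \<open>b\<close> outside \<open>R\<close> stabilised \<open>J\<close>, split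
  \<open>inverse b\<close> into nonunits \<open>s\<close> and \<open>inverse b / s\<close>. Then
  \<open>b * s\<close> would stabilise the whole quotient, although it is the inverse of a
  nonunit.\<close>

lemma inv_ring_squeezed:
  assumes J: "is_submodule R J" and lower: "\<And>y t. y \<in> colon I2 I1 \<Longrightarrow> t \<in> nonunits \<Longrightarrow> y * t \<in> J"
    and upper: "J \<subseteq> colon I2 I1"
  shows "inv_ring J = R"
proof (rule ccontr)
  assume "inv_ring J \<noteq> R"
  moreover have "R \<subseteq> inv_ring J" using J by (auto simp: mem_inv_ring_iff is_submodule_def)
  ultimately obtain b where b: "b \<in> inv_ring J" "b \<notin> R" by blast
  have "b \<noteq> 0" "inverse b \<in> nonunits" using b(2) zero_mem by (auto simp: nonunits_def)
  then obtain s where s: "s \<in> nonunits" "s \<noteq> 0" "inverse b / s \<in> nonunits"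
    using nonunits_idempotent[OF np1 inv1, of "inverse b"] by auto
  have "b * (y * s) \<in> colon I2 I1" if "y \<in> colon I2 I1" for y
    using lower[OF that s(1)] b(1) upper by (auto simp: mem_inv_ring_iff)
  then have "b * s \<in> inv_ring (colon I2 I1)" by (simp add: mem_inv_ring_iff ac_simps)
  then have "b * s \<in> R" by (simp add: inv_ring_colon)
  moreover have "inverse (inverse b / s) = b * s" by (simp add: field_simps)
  ultimately show False using nonunit_inverse_not_mem[OF s(3)] s(2) \<open>b \<noteq> 0\<close> by auto
qed

text \<open>For a nonunit \<open>t\<close>, the quotient contains \<open>a * t\<close>: otherwise
  \<open>J\<close> would lie in \<open>scale (a * t) R\<close>, and maximality of \<open>a\<close>
  among the lower bounds would make \<open>t\<close> a unit. As \<open>I1\<close> is nonprincipal,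
  each of its elements is a nonunit times another one, which allows \<open>t\<close> to be
  removed.\<close>

lemma generator_mem_colon:
  assumes "a \<noteq> 0" and upper: "J \<subseteq> colon I2 I1"
    and glb: "\<And>b. b \<noteq> 0 \<Longrightarrow> J \<subseteq> scale b R \<Longrightarrow> a \<in> scale b R"
  shows "a \<in> colon I2 I1"
proof (rule ccontr)
  assume a: "a \<notin> colon I2 I1"
  have I: "is_submodule R I1" "is_submodule R I2"
    using np1 np2 by (auto simp: nonprincipal_ideal_def is_ideal_def)
  have C: "is_submodule R (colon I2 I1)" by (rule is_submodule_colon[OF I(2)])
  have all: "a * t \<in> colon I2 I1" if t: "t \<in> nonunits" for t
  proof (rule ccontr)
    assume not_mem: "a * t \<notin> colon I2 I1"
    then have "t \<noteq> 0" using C by (auto simp: is_submodule_def)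
    have "J \<subseteq> scale (a * t) R" using subset_scale[OF C not_mem] upper by blast
    then have "a \<in> scale (a * t) R" using glb \<open>a \<noteq> 0\<close> \<open>t \<noteq> 0\<close> by simp
    then have "inverse t \<in> R" using \<open>a \<noteq> 0\<close> \<open>t \<noteq> 0\<close> by (simp add: mem_scale_iff inverse_eq_divide)
    with nonunit_inverse_not_mem[OF t \<open>t \<noteq> 0\<close>] show False by simp
  qed
  have "a * x \<in> I2" if x: "x \<in> I1" for x
  proof -
    obtain d where d: "d \<in> I1" "d \<noteq> 0" "x / d \<in> nonunits"
      using nonprincipal_nonunit_quotient[OF np1 x] .
    have "a * (x / d) * d \<in> I2" using all[OF d(3)] d(1) by (auto simp: mem_colon_iff)
    then show ?thesis using d(2) by simp
  qed
  with a show False by (simp add: mem_colon_iff)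
qed

text \<open>If \<open>y\<close> were outside, the nonunit \<open>a / y\<close> would split into two
  nonunits. For the factor \<open>s\<close>, the value of \<open>y * s\<close> would still be
  strictly below that of \<open>a\<close>.\<close>

lemma nonunit_multiples_not_principal:
  assumes "a \<noteq> 0" "\<And>t. t \<in> nonunits \<Longrightarrow> y * t \<in> scale a R"
  shows "y \<in> scale a R"
proof (rule ccontr)
  assume y: "y \<notin> scale a R"
  have aR: "is_submodule R (scale a R)" "a \<in> scale a R"
    using is_submodule_scale[OF is_submodule_self] one_mem by (force simp: scale_def)+
  then have "y \<noteq> 0" using y by (auto simp: is_submodule_def)
  have "a / y \<in> nonunits" by (rule div_mem_nonunits[OF aR y])
  then obtain s where s: "s \<in> nonunits" "s \<noteq> 0" "a / y / s \<in> nonunits"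
    using nonunits_idempotent[OF np1 inv1, of "a / y"] \<open>a \<noteq> 0\<close> \<open>y \<noteq> 0\<close> by auto
  have "y * s / a \<in> R" using assms(2)[OF s(1)] \<open>a \<noteq> 0\<close> by (simp add: mem_scale_iff)
  moreover have "inverse (a / y / s) \<notin> R"
    using nonunit_inverse_not_mem[OF s(3)] s(2) \<open>a \<noteq> 0\<close> \<open>y \<noteq> 0\<close> by simp
  ultimately show False by (simp add: mult.commute)
qed

lemma diamond_squeezed:
  assumes J: "is_submodule R J" and lower: "\<And>y t. y \<in> colon I2 I1 \<Longrightarrow> t \<in> nonunits \<Longrightarrow> y * t \<in> J"
    and upper: "J \<subseteq> colon I2 I1"
  shows "diamond J = colon I2 I1"
proof -
  have "hat R J = colon I2 I1"
  proof (rule hat_eq)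
    have C: "is_submodule R (colon I2 I1)"
      using np2 by (auto simp: nonprincipal_ideal_def is_ideal_def intro: is_submodule_colon)
    {
      fix a assume a: "a \<noteq> 0" "J \<subseteq> scale a R" "\<And>b. b \<noteq> 0 \<Longrightarrow> J \<subseteq> scale b R \<Longrightarrow> a \<in> scale b R"
      have "colon I2 I1 \<subseteq> scale a R"
        using nonunit_multiples_not_principal[OF a(1)] lower a(2) by blast
      moreover have "scale a R \<subseteq> colon I2 I1"
        by (rule scale_subset[OF C]) (rule generator_mem_colon[OF a(1) upper], use a(3) in blast)
      ultimately show "scale a R = colon I2 I1" by blast
    }
    assume no_inf: "\<And>a. a \<noteq> 0 \<Longrightarrow> J \<subseteq> scale a R \<Longrightarrow>
        \<exists>b. b \<noteq> 0 \<and> J \<subseteq> scale b R \<and> a \<notin> scale b R"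
    show "J = colon I2 I1"
    proof (rule ccontr)
      assume "J \<noteq> colon I2 I1"
      then obtain y where y: "y \<in> colon I2 I1" "y \<notin> J" using upper by blast
      then have "y \<noteq> 0" using J by (auto simp: is_submodule_def)
      \<comment> \<open>Since \<open>y\<close> is outside \<open>J\<close>, \<open>scale y R\<close>
        contains \<open>J\<close> but is not the smallest such module. Some \<open>scale b R\<close>
        thus contains \<open>J\<close> and misses \<open>y\<close>, although it contains all nonunit
        multiples of \<open>y\<close>.\<close>
      with no_inf subset_scale[OF J y(2)]
      obtain b where b: "b \<noteq> 0" "J \<subseteq> scale b R" "y \<notin> scale b R" by blast
      then show False using nonunit_multiples_not_principal[OF b(1), of y] lower[OF y(1)] by blast
    qed
  qed
  moreover have "inv_ring J = R" by (rule inv_ring_squeezed) (use assms in auto)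
  ultimately show ?thesis by (simp add: diamond_def)
qed

end

section \<open>Obstructions to solvability\<close>

text \<open>Write the generator \<open>a\<close> of \<open>I2\<close> as \<open>x * y\<close>.
  Replacing \<open>x\<close> by an element \<open>d\<close> of \<open>I1\<close> of smaller value
  over \<open>S\<close> gives a product in \<open>I2\<close> with value below that of
  \<open>a\<close>.\<close>

lemma no_solution_principal:
  assumes I1: "is_ideal R I1" and J: "solves R I1 I2 J"
    and S: "valuation_ring S" "nonprincipal_ideal S I1" "principal_ideal S I2"
  shows False
proof -
  interpret S: valuation_ring S by fact
  obtain a where a: "I2 = scale a S" using S(3) by (auto simp: principal_ideal_def)
  have "I2 \<noteq> {0}" using S(3) by (simp add: principal_ideal_def is_ideal_def)
  then have "a \<noteq> 0" using a S.one_mem by (auto simp: scale_def)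
  have prod: "I2 = {x * y | x y. x \<in> I1 \<and> y \<in> J}"
    using I1 J ideal_prod_eq by (auto simp: solves_def is_ideal_def)
  have "a \<in> I2" using a S.one_mem by (force simp: scale_def)
  then obtain x y where xy: "a = x * y" "x \<in> I1" "y \<in> J" using prod by blast
  obtain d where d: "d \<in> I1" "d \<notin> scale x S"
    using S.nonprincipal_no_generator[OF S(2) xy(2)] .
  have "d * y \<in> scale a S" using prod a d(1) xy(3) by blast
  with d(2) \<open>a \<noteq> 0\<close> xy(1) show False by (auto simp: mem_scale_iff)
qed

lemma solves_inv_ring_subset:
  assumes I1: "is_ideal R I1" and J: "solves R I1 I2 J"
  shows "inv_ring I1 \<subseteq> inv_ring I2"
proof
  have prod: "I2 = {x * y | x y. x \<in> I1 \<and> y \<in> J}"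
    using I1 J ideal_prod_eq by (auto simp: solves_def is_ideal_def)
  fix b assume b: "b \<in> inv_ring I1"
  have "b * c \<in> I2" if "c \<in> I2" for c
  proof -
    obtain x y where xy: "c = x * y" "x \<in> I1" "y \<in> J" using \<open>c \<in> I2\<close> prod by blast
    have "b * x \<in> I1" using b xy(2) by (simp add: mem_inv_ring_iff)
    then have "(b * x) * y \<in> I2" using xy(3) prod by blast
    then show ?thesis by (simp add: xy(1) mult.assoc)
  qed
  then show "b \<in> inv_ring I2" by (simp add: mem_inv_ring_iff)
qed

section \<open>The diamond formula for the quotient\<close>

text \<open>The formula in the theorem takes the quotient over \<open>R\<close>, the argument below works over \<open>S\<close>.\<close>

lemma colon_nonprincipal:
  assumes S: "valuation_ring S" "R \<subseteq> S" and np: "nonprincipal_ideal S I"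
  shows "colon R I = colon S I"
proof (intro equalityI subsetI)
  interpret S: valuation_ring S by fact
  fix a assume a: "a \<in> colon S I"
  have "a * x \<in> R" if x: "x \<in> I" for x
  proof (rule ccontr)
    assume not_mem: "a * x \<notin> R"
    \<comment> \<open>Over \<open>S\<close>, \<open>d\<close> lies strictly below \<open>x\<close>.
      If \<open>inverse (a * x)\<close> is in \<open>S\<close>, multiplying it by
      \<open>a * d\<close> puts \<open>d / x\<close> into \<open>S\<close>, a contradiction.\<close>
    obtain d where d: "d \<in> I" "d \<noteq> 0" "x / d \<in> S.nonunits"
      using S.nonprincipal_nonunit_quotient[OF np x] .
    have nz: "a \<noteq> 0" "x \<noteq> 0" using not_mem zero_mem by auto
    have "a * d \<in> S" using a d(1) by (simp add: mem_colon_iff)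
    moreover have "inverse (a * x) \<in> S" using total[of "a * x"] not_mem S(2) by blast
    ultimately have "(a * d) * inverse (a * x) \<in> S" by (rule S.mult_mem)
    moreover have "inverse (x / d) = (a * d) * inverse (a * x)"
      using nz by (simp add: field_simps)
    ultimately show False using S.nonunit_inverse_not_mem[OF d(3)] d(2) nz by simp
  qed
  then show "a \<in> colon R I" by (simp add: mem_colon_iff)
qed (use S(2) in \<open>auto simp: mem_colon_iff\<close>)

lemma diamond_prod_colon:
  assumes S: "valuation_ring S" "R \<subseteq> S"
    and np: "nonprincipal_ideal S I1" "nonprincipal_ideal S I2"
    and inv: "inv_ring I1 = S" "inv_ring I2 = S"
  shows "diamond (ideal_prod R I2 (colon R I1)) = colon I2 I1"
proof -
  interpret S: valuation_ring S by fact
  have sub: "is_submodule S I2" "is_submodule S (colon S I1)"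
    using np is_submodule_colon[OF S.is_submodule_self]
    by (auto simp: nonprincipal_ideal_def is_ideal_def)
  have colon: "colon R I1 = colon S I1" by (rule colon_nonprincipal[OF S np(1)])
  have prod: "ideal_prod R I2 (colon R I1) = {x * y | x y. x \<in> I2 \<and> y \<in> colon S I1}"
    unfolding colon
    by (rule ideal_prod_eq) (use sub is_submodule_antimono[OF S(2)] in auto)
  show ?thesis
  proof (rule S.diamond_squeezed[OF np inv])
    show "is_submodule S (ideal_prod R I2 (colon R I1))"
      unfolding prod by (rule S.is_submodule_products[OF sub])
    show "ideal_prod R I2 (colon R I1) \<subseteq> colon I2 I1"
    proof
      fix z assume "z \<in> ideal_prod R I2 (colon R I1)"
      then obtain x y where z: "z = x * y" "x \<in> I2" "y \<in> colon S I1" unfolding prod by blast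
      have "(y * w) * x \<in> I2" if "w \<in> I1" for w
        by (rule submodule_mult[OF sub(1)]) (use z that in \<open>auto simp: mem_colon_iff\<close>)
      then show "z \<in> colon I2 I1" by (simp add: z(1) mem_colon_iff ac_simps)
    qed
  next
    fix y t assume y: "y \<in> colon I2 I1" and t: "t \<in> S.nonunits"
    show "y * t \<in> ideal_prod R I2 (colon R I1)"
    proof (cases "t = 0")
      case True
      then show ?thesis
        using sub S.is_submodule_products[OF sub] by (simp add: prod is_submodule_def)
    next
      case False
      \<comment> \<open>As \<open>c / t\<close> is outside \<open>I2\<close>, it divides every
        \<open>y * x\<close> with \<open>x\<close> in \<open>I1\<close>. So \<open>y * t / c\<close>
        maps \<open>I1\<close> into \<open>S\<close>, and \<open>y * t\<close> is the product of
        \<open>c\<close> with it.\<close>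
      obtain c where c: "c \<in> I2" "c / t \<notin> I2" using S.not_stabilised[OF inv(2) t False] .
      have "c \<noteq> 0" using c sub(1) by (auto simp: is_submodule_def)
      have "(y * t / c) * x \<in> S" if "x \<in> I1" for x
      proof -
        have "y * x \<in> I2" using y that by (simp add: mem_colon_iff)
        then have "y * x / (c / t) \<in> S"
          using S.div_mem_nonunits[OF sub(1) _ c(2)] S.nonunits_subset by blast
        then show ?thesis by (simp add: ac_simps)
      qed
      then have "y * t / c \<in> colon S I1" by (simp add: mem_colon_iff)
      moreover have "y * t = c * (y * t / c)" using \<open>c \<noteq> 0\<close> by simp
      ultimately show ?thesis unfolding prod using c(1) by blast
    qed
  qed
qed

section \<open>The solvability condition and its negation\<close>

lemma inv_ring_neq_UNIV:
  assumes "is_ideal R I" shows "inv_ring I \<noteq> UNIV"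
proof
  assume *: "inv_ring I = UNIV"
  obtain x where x: "x \<in> I" "x \<noteq> 0" using assms by (rule ideal_nonzero_element)
  have "(z / x) * x \<in> I" for z using * x(1) by (metis UNIV_I mem_inv_ring_iff)
  then have "I = UNIV" using x(2) by auto
  with assms show False by (simp add: is_ideal_def)
qed

text \<open>Both invariance rings contain \<open>R\<close> and are hence comparable. If
  \<open>I1\<close> is a module over \<open>inv_ring I2\<close>, then
  \<open>inv_ring I2 \<subseteq> inv_ring I1\<close>; so when the inclusion in the condition holds,
  its second part can fail only for equal rings.\<close>

lemma not_cond_star_iff:
  assumes "is_ideal R I1" "is_ideal R I2"
  shows "\<not> cond_star I1 I2 \<longleftrightarrow>
    inv_ring I2 \<subset> inv_ring I1 \<or>
    inv_ring I1 = inv_ring I2 \<and>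
      nonprincipal_ideal (inv_ring I1) I1 \<and> principal_ideal (inv_ring I1) I2"
proof -
  have linear: "inv_ring I1 \<subseteq> inv_ring I2 \<or> inv_ring I2 \<subset> inv_ring I1"
  proof -
    have "is_submodule R (inv_ring I)" if "is_ideal R I" for I
      using is_submodule_antimono[OF ideal_subset_inv_ring[OF that]
          valuation_ring.is_submodule_self[OF valuation_ring_inv_ring[OF that]]] .
    then show ?thesis using submodule_linear[of "inv_ring I1" "inv_ring I2"] assms by blast
  qed
  have "nonprincipal_ideal (inv_ring I2) I1 \<Longrightarrow> inv_ring I2 \<subseteq> inv_ring I1"
    by (rule ideal_subset_inv_ring) (simp add: nonprincipal_ideal_def)
  with linear is_ideal_inv_ring[OF assms(2)] show ?thesis
    unfolding cond_star_def principal_ideal_def nonprincipal_ideal_def by auto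
qed

lemma colon_solution:
  assumes I1: "is_ideal R I1" and I2: "is_ideal R I2" and star: "cond_star I1 I2"
  shows "solves R I1 I2 (colon I2 I1)"
    and "nonprincipal_ideal (inv_ring I2) (ideal_prod R I1 (inv_ring I2)) \<Longrightarrow>
      colon I2 I1 = diamond (ideal_prod R I2 (colon R I1))"
proof -
  let ?S = "inv_ring I2"
  have S: "valuation_ring ?S" "R \<subseteq> ?S" "?S \<noteq> UNIV"
    by (rule valuation_ring_inv_ring[OF I2] ideal_subset_inv_ring[OF I2]
        inv_ring_neq_UNIV[OF I2])+
  have sub2: "is_submodule ?S I2" using is_ideal_inv_ring[OF I2] by (simp add: is_ideal_def)
  \<comment> \<open>A nonprincipal extension equals \<open>I1\<close>, so \<open>I1\<close> is an
    \<open>inv_ring I2\<close>-module. The condition then makes \<open>I2\<close> nonprincipal and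
    supplies the other inclusion between the invariance rings.\<close>
  have np: "nonprincipal_ideal ?S I1" "nonprincipal_ideal ?S I2" "inv_ring I1 = ?S"
    if "nonprincipal_ideal ?S (ideal_prod R I1 ?S)"
  proof -
    show np1: "nonprincipal_ideal ?S I1"
      using that nonprincipal_extension_eq[OF I1 S(1,2)] by simp
    with star show "nonprincipal_ideal ?S I2" by (simp add: cond_star_def)
    show "inv_ring I1 = ?S"
      using star np1 ideal_subset_inv_ring[of ?S I1]
      by (auto simp: cond_star_def nonprincipal_ideal_def)
  qed
  show "solves R I1 I2 (colon I2 I1)"
  proof (rule solves_colonI[OF I1 I2])
    fix c assume c: "c \<in> I2"
    show "\<exists>x\<in>I1. \<exists>y\<in>colon I2 I1. c = x * y"
    proof (cases "\<exists>a. ideal_prod R I1 ?S = scale a ?S")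
      case True
      then show ?thesis using colon_principal(2)[OF I1 S(1,2) sub2 _ c] by blast
    next
      case False
      then have "nonprincipal_ideal ?S (ideal_prod R I1 ?S)"
        using is_ideal_extension[OF I1 S] by (simp add: nonprincipal_ideal_def)
      from np[OF this] show ?thesis
        using valuation_ring.nonprincipal_factor[OF S(1)] c by blast
    qed
  qed
  assume "nonprincipal_ideal ?S (ideal_prod R I1 ?S)"
  from np[OF this] show "colon I2 I1 = diamond (ideal_prod R I2 (colon R I1))"
    using diamond_prod_colon[OF S(1,2)] by simp
qed

lemma no_solution:
  assumes I1: "is_ideal R I1" and I2: "is_ideal R I2" and star: "\<not> cond_star I1 I2"
  shows "\<not> solves R I1 I2 J"
  using star[unfolded not_cond_star_iff[OF I1 I2]] solves_inv_ring_subset[OF I1]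
    no_solution_principal[OF I1 _ valuation_ring_inv_ring[OF I1]]
  by blast

end

section \<open>The valuation ring of a valuation, and the theorem\<close>

lemma valuation_ring_val_ring:
  fixes v :: "'a::field \<Rightarrow> 'g::linordered_ab_group_add extended"
  assumes "is_valuation v"
  shows "valuation_ring (val_ring v)"
proof
  have mult: "v (x * y) = v x + v y" and add: "min (v x) (v y) \<le> v (x + y)"
    and Minf: "v x \<noteq> Minf" and Pinf: "v x = Pinf \<longleftrightarrow> x = 0" for x y
    using assms by (auto simp: is_valuation_def)
  \<comment> \<open>From \<open>1 * 1 = 1\<close> the finite value of \<open>1\<close> is idempotent
    under addition.\<close>
  have one: "v 1 = 0"
    using mult[of 1 1] Minf[of 1] Pinf[of 1] by (cases "v 1") (auto simp: zero_extended_def)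
  then show "1 \<in> val_ring v" by (simp add: val_ring_def)
  show "x + y \<in> val_ring v" if "x \<in> val_ring v" "y \<in> val_ring v" for x y
    using that add[of x y] by (auto simp: val_ring_def min_def split: if_splits)
  show "x * y \<in> val_ring v" if "x \<in> val_ring v" "y \<in> val_ring v" for x y
    using that by (cases "v x"; cases "v y") (auto simp: val_ring_def mult zero_extended_def)
  show "x \<in> val_ring v \<or> inverse x \<in> val_ring v" for x
  proof (cases "x = 0")
    case True
    then show ?thesis using Pinf[of 0] by (simp add: val_ring_def zero_extended_def)
  next
    case False
    then have "v x + v (inverse x) = 0" using mult[of x "inverse x"] one by simp
    \<comment> \<open>A sum equal to \<open>0\<close> forces both values to be finite; the
      \<open>case\<close> terms extract them, and two negative ones would have a negative
      sum.\<close>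
    then show ?thesis
      using add_neg_neg[of "case v x of Fin a \<Rightarrow> a" "case v (inverse x) of Fin a \<Rightarrow> a"]
      by (cases "v x"; cases "v (inverse x)")
        (auto simp: val_ring_def zero_extended_def not_le[symmetric])
  qed
qed

theorem theorem3p13:
  fixes v :: "'a::field \<Rightarrow> 'g::linordered_ab_group_add extended"
    and I1 I2 :: "'a set"
  assumes "is_valuation v"
    and "is_ideal (val_ring v) I1"
    and "is_ideal (val_ring v) I2"
  shows
    "(cond_star I1 I2 \<longrightarrow>
        solves (val_ring v) I1 I2 (colon I2 I1) \<and>
        (\<forall>J. solves (val_ring v) I1 I2 J \<longrightarrow> J \<subseteq> colon I2 I1) \<and>
        (\<forall>a. ideal_prod (val_ring v) I1 (inv_ring I2) = scale a (inv_ring I2) \<longrightarrow>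
             colon I2 I1 = scale (inverse a) I2) \<and>
        (nonprincipal_ideal (inv_ring I2) (ideal_prod (val_ring v) I1 (inv_ring I2)) \<longrightarrow>
             colon I2 I1 = diamond (ideal_prod (val_ring v) I2 (colon (val_ring v) I1)))) \<and>
     (\<not> cond_star I1 I2 \<longleftrightarrow>
        inv_ring I2 \<subset> inv_ring I1 \<or>
        inv_ring I1 = inv_ring I2 \<and>
          nonprincipal_ideal (inv_ring I1) I1 \<and> principal_ideal (inv_ring I1) I2) \<and>
     (\<not> cond_star I1 I2 \<longrightarrow> \<not> (\<exists>J. solves (val_ring v) I1 I2 J))"
proof -
  interpret valuation_ring "val_ring v" using assms(1) by (rule valuation_ring_val_ring)
  have "colon I2 I1 = scale (inverse a) I2"
    if "ideal_prod (val_ring v) I1 (inv_ring I2) = scale a (inv_ring I2)" for a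
    using colon_principal(1)[OF assms(2) valuation_ring_inv_ring[OF assms(3)]
        ideal_subset_inv_ring[OF assms(3)] _ that] is_ideal_inv_ring[OF assms(3)]
    by (simp add: is_ideal_def)
  moreover note colon_solution[OF assms(2,3)] solves_subset_colon[OF assms(2)]
    no_solution[OF assms(2,3)]
  ultimately show ?thesis by (intro conjI impI allI not_cond_star_iff[OF assms(2,3)] notI) blast+
qed

end
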